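(* Let $\mathbf{A}$ be a normal and quasicomplemented distributive nearlattice. Then there exists a one-to-one correspondence (bijection) between the set of $\alpha$-ideals of $A$ and the set of $\alpha$-filters of $A$.
   Context: A distributive nearlattice is a join-semilattice $\langle A,\vee,1\rangle$ with greatest element $1$ in which every principal filter $[a)=\{x\in A\colon a\le x\}$ is a bounded distributive lattice. A filter of $A$ is a subset containing $1$, upward closed, and closed under those binary meets that exist. An ideal is a non-empty subset that is downward closed and closed under $\vee$. For $a\in A$, $a^{\top}=\{x\in A\colon x\vee a=1\}$ and $a^{\top\top}=\{y\in A\colon y\vee x=1\text{ for all }x\in a^{\top}\}$. A filter $F$ is an $\alpha$-filter if $a^{\top\top}\subseteq F$ for all $a\in F$. An ideal $I$ is an $\alpha$-ideal if for each $a\in A$, $I\cap a^{\top\top}\neq\emptyset$ implies $a\in I$. A prime ideal is a proper ideal $P$ with $a\wedge b\in P\Rightarrow a\in P$ or $b\in P$ whenever $a\wedge b$ exists; a maximal ideal is a proper ideal not properly contained in any proper ideal. $\mathbf{A}$ is normal if each prime ideal is contained in a unique maximal ideal; $\mathbf{A}$ is quasicomplemented if for each $a\in A$ there exists $b\in A$ with $a^{\top\top}=b^{\top}$. *)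

theory Defs
  imports Main
begin

context order
begin

definition is_meet_on :: "'a set \<Rightarrow> 'a \<Rightarrow> 'a \<Rightarrow> 'a \<Rightarrow> bool" where
  "is_meet_on S x y m \<longleftrightarrow>
     m \<in> S \<and> m \<le> x \<and> m \<le> y \<and> (\<forall>z\<in>S. z \<le> x \<and> z \<le> y \<longrightarrow> z \<le> m)"

definition is_join_on :: "'a set \<Rightarrow> 'a \<Rightarrow> 'a \<Rightarrow> 'a \<Rightarrow> bool" where
  "is_join_on S x y j \<longleftrightarrow>
     j \<in> S \<and> x \<le> j \<and> y \<le> j \<and> (\<forall>z\<in>S. x \<le> z \<and> y \<le> z \<longrightarrow> j \<le> z)"

definition meet_on :: "'a set \<Rightarrow> 'a \<Rightarrow> 'a \<Rightarrow> 'a" where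
  "meet_on S x y = (THE m. is_meet_on S x y m)"

definition join_on :: "'a set \<Rightarrow> 'a \<Rightarrow> 'a \<Rightarrow> 'a" where
  "join_on S x y = (THE j. is_join_on S x y j)"

definition lattice_on :: "'a set \<Rightarrow> bool" where
  "lattice_on S \<longleftrightarrow>
     (\<forall>x\<in>S. \<forall>y\<in>S. (\<exists>m. is_meet_on S x y m) \<and> (\<exists>j. is_join_on S x y j))"

definition bounded_distributive_lattice_on :: "'a set \<Rightarrow> bool" where
  "bounded_distributive_lattice_on S \<longleftrightarrow>
     lattice_on S \<and>
     (\<exists>l\<in>S. \<forall>x\<in>S. l \<le> x) \<and> (\<exists>u\<in>S. \<forall>x\<in>S. x \<le> u) \<and>
     (\<forall>x\<in>S. \<forall>y\<in>S. \<forall>z\<in>S.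
        meet_on S x (join_on S y z) = join_on S (meet_on S x y) (meet_on S x z))"

end

text \<open>The carrier is the whole type; \<^term>\<open>{a..}\<close> is the principal filter of a.\<close>

class distributive_nearlattice = semilattice_sup + order_top +
  assumes principal_filter: "bounded_distributive_lattice_on {a..}"

context distributive_nearlattice
begin

text \<open>Meets in a nearlattice are partial: \<^term>\<open>is_meet_on UNIV x y m\<close> says that the meet
  of x and y exists and equals m.\<close>

definition nl_filter :: "'a set \<Rightarrow> bool" where
  "nl_filter F \<longleftrightarrow>
     top \<in> F \<and>
     (\<forall>x y. x \<in> F \<and> x \<le> y \<longrightarrow> y \<in> F) \<and>
     (\<forall>x\<in>F. \<forall>y\<in>F. \<forall>m. is_meet_on UNIV x y m \<longrightarrow> m \<in> F)"

definition nl_ideal :: "'a set \<Rightarrow> bool" where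
  "nl_ideal I \<longleftrightarrow>
     I \<noteq> {} \<and>
     (\<forall>x y. x \<in> I \<and> y \<le> x \<longrightarrow> y \<in> I) \<and>
     (\<forall>x\<in>I. \<forall>y\<in>I. sup x y \<in> I)"

definition annihilator :: "'a \<Rightarrow> 'a set" where
  "annihilator a = {x. sup x a = top}"

definition double_annihilator :: "'a \<Rightarrow> 'a set" where
  "double_annihilator a = {y. \<forall>x\<in>annihilator a. sup y x = top}"

definition alpha_filter :: "'a set \<Rightarrow> bool" where
  "alpha_filter F \<longleftrightarrow> nl_filter F \<and> (\<forall>a\<in>F. double_annihilator a \<subseteq> F)"

definition alpha_ideal :: "'a set \<Rightarrow> bool" where
  "alpha_ideal I \<longleftrightarrow> nl_ideal I \<and> (\<forall>a. I \<inter> double_annihilator a \<noteq> {} \<longrightarrow> a \<in> I)"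

definition nl_prime_ideal :: "'a set \<Rightarrow> bool" where
  "nl_prime_ideal P \<longleftrightarrow>
     nl_ideal P \<and> P \<noteq> UNIV \<and>
     (\<forall>a b m. is_meet_on UNIV a b m \<and> m \<in> P \<longrightarrow> a \<in> P \<or> b \<in> P)"

definition nl_maximal_ideal :: "'a set \<Rightarrow> bool" where
  "nl_maximal_ideal M \<longleftrightarrow>
     nl_ideal M \<and> M \<noteq> UNIV \<and>
     \<not> (\<exists>J. nl_ideal J \<and> J \<noteq> UNIV \<and> M \<subset> J)"

end

definition nl_normal :: "'a::distributive_nearlattice itself \<Rightarrow> bool" where
  "nl_normal _ \<longleftrightarrow>
     (\<forall>P::'a set. nl_prime_ideal P \<longrightarrow> (\<exists>!M. nl_maximal_ideal M \<and> P \<subseteq> M))"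

definition nl_quasicomplemented :: "'a::distributive_nearlattice itself \<Rightarrow> bool" where
  "nl_quasicomplemented _ \<longleftrightarrow>
     (\<forall>a::'a. \<exists>b. double_annihilator a = annihilator b)"

end

theory Submission
  imports Defs
begin

text \<open>
  To an \<open>\<alpha>\<close>-ideal \<open>I\<close> associate the union of the annihilators of its elements, and to an
  \<open>\<alpha>\<close>-filter \<open>F\<close> the set of all \<open>x\<close> whose annihilator lies in \<open>F\<close>. Quasicomplements show that
  these maps are mutually inverse. Normality is needed only to see that the second
  set is closed under joins: if \<open>F\<close> contains the annihilators of \<open>a\<close> and \<open>b\<close> but misses some \<open>x\<close>
  with \<open>x \<squnion> a \<squnion> b = 1\<close>, then a prime ideal through \<open>x\<close> avoiding \<open>F\<close> stays proper after adding
  either \<open>a\<close> or \<open>b\<close>, so its unique maximal extension contains \<open>x\<close>, \<open>a\<close> and \<open>b\<close>, hence \<open>1\<close>.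
\<close>

context distributive_nearlattice
begin

section \<open>Distributivity in principal filters and partial meets\<close>

text \<open>Distributivity in \<open>{m..}\<close>: \<open>w\<close> is the meet of \<open>w\<close>
  and \<open>sup s u\<close>, so it is the join of \<open>p\<close> and \<open>q\<close>, its meets
  with \<open>s\<close> and \<open>u\<close>. The common lower bound \<open>m\<close> makes these
  meets exist.\<close>

lemma le_sup_split:
  assumes "m \<le> w" "m \<le> s" "m \<le> u" "w \<le> sup s u"
  obtains p q where "p \<le> w" "p \<le> s" "m \<le> q" "q \<le> w" "q \<le> u" "w = sup p q"
proof -
  note pf = principal_filter[of m, unfolded bounded_distributive_lattice_on_def lattice_on_def]
  have mt: "meet_on {m..} x y = n" if "is_meet_on {m..} x y n" for x y n
    unfolding meet_on_def
    by (rule the_equality) (use that in \<open>auto simp: is_meet_on_def intro: order.antisym\<close>)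
  have jn: "join_on {m..} x y = sup x y" if "m \<le> x" "m \<le> y" for x y
    unfolding join_on_def
    by (rule the_equality)
      (use that in \<open>auto simp: is_join_on_def le_supI1 intro!: order.antisym\<close>)
  obtain p where p: "is_meet_on {m..} w s p"
    using pf assms by (meson atLeast_iff)
  obtain q where q: "is_meet_on {m..} w u q"
    using pf assms by (meson atLeast_iff)
  have w: "is_meet_on {m..} w (sup s u) w"
    using assms by (auto simp: is_meet_on_def)
  have "meet_on {m..} w (join_on {m..} s u) = join_on {m..} (meet_on {m..} w s) (meet_on {m..} w u)"
    using pf assms by auto
  moreover have "m \<le> p" "m \<le> q" using p q by (auto simp: is_meet_on_def)
  ultimately have "w = sup p q"
    using assms by (simp add: jn mt[OF p] mt[OF q] mt[OF w])
  then show thesis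
    using p q by (intro that[of p q]) (auto simp: is_meet_on_def)
qed

text \<open>Joining with \<open>r\<close> preserves every meet that exists; this replaces the
  distributive law where meets are partial.\<close>

lemma sup_is_meet_on:
  assumes "is_meet_on UNIV u v m"
  shows "is_meet_on UNIV (sup r u) (sup r v) (sup r m)"
proof -
  have m: "m \<le> u" "m \<le> v" and glb: "\<And>z. z \<le> u \<Longrightarrow> z \<le> v \<Longrightarrow> z \<le> m"
    using assms by (auto simp: is_meet_on_def)
  have "z \<le> sup r m" if z: "z \<le> sup r u" "z \<le> sup r v" for z
  proof -
    let ?s = "sup r m"
    \<comment> \<open>\<open>z\<close> itself need not lie above \<open>m\<close>; joining with
      \<open>m\<close> moves it into \<open>{m..}\<close>. Splitting \<open>?w\<close> along
      \<open>sup ?s u\<close>, then the remainder \<open>q\<close> along \<open>sup ?s v\<close>,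
      leaves a piece below both \<open>u\<close> and \<open>v\<close>, hence below
      \<open>m\<close>.\<close>
    let ?w = "sup z m"
    have "?w \<le> sup ?s u" "?w \<le> sup ?s v"
      using z m by (simp_all add: sup_assoc sup_absorb2 le_supI2)
    obtain p q where pq: "p \<le> ?s" "m \<le> q" "q \<le> ?w" "q \<le> u" "?w = sup p q"
      by (rule le_sup_split[of m ?w ?s u]) (use \<open>?w \<le> sup ?s u\<close> m in auto)
    have "q \<le> sup ?s v"
      using pq(3) \<open>?w \<le> sup ?s v\<close> by (rule order.trans)
    obtain p' q' where pq': "p' \<le> ?s" "q' \<le> q" "q' \<le> v" "q = sup p' q'"
      by (rule le_sup_split[of m q ?s v]) (use \<open>q \<le> sup ?s v\<close> m pq in auto)
    have "q' \<le> m" using pq pq' glb order.trans by blast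
    then have "q \<le> ?s" using pq' by (simp add: le_supI2)
    then have "?w \<le> ?s" using pq by simp
    then show ?thesis by simp
  qed
  then show ?thesis
    using m by (auto simp: is_meet_on_def le_supI2)
qed

text \<open>For meets, \<open>sup a m\<close> is the meet of \<open>sup a x\<close> and
  \<open>sup a y\<close>; both are \<open>top\<close>, so it is \<open>top\<close> as well.\<close>

lemma nl_filter_annihilator: "nl_filter (annihilator a)"
proof -
  have "sup m a = top"
    if "sup x a = top" "sup y a = top" "is_meet_on UNIV x y m" for x y m
  proof (rule order.antisym)
    show "top \<le> sup m a"
      using sup_is_meet_on[OF that(3), of a] that(1,2) unfolding is_meet_on_def
      by (metis UNIV_I order.refl sup_commute)
  qed simp
  moreover have "sup y a = top" if "sup x a = top" "x \<le> y" for x y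
    using sup_mono[OF that(2) order.refl, of a] that(1) by (simp add: top_unique)
  moreover have "sup top a = top" by (simp add: sup_absorb1)
  ultimately show ?thesis
    unfolding nl_filter_def annihilator_def by blast
qed

section \<open>Ideals, maximal ideals and prime separation\<close>

lemma nl_ideal_proper_iff: "nl_ideal I \<Longrightarrow> I \<noteq> UNIV \<longleftrightarrow> top \<notin> I"
  unfolding nl_ideal_def by (metis UNIV_I UNIV_eq_I top_greatest)

lemma nl_ideal_principal: "nl_ideal {..x}"
  by (auto simp: nl_ideal_def)

text \<open>This set is the ideal generated by \<open>I\<close> and \<open>a\<close>.\<close>

lemma nl_ideal_adjoin:
  assumes "nl_ideal I"
  shows "nl_ideal {z. \<exists>p\<in>I. z \<le> sup p a}"
  unfolding nl_ideal_def
proof (intro conjI allI ballI impI)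
  obtain p where "p \<in> I" using assms by (auto simp: nl_ideal_def)
  then show "{z. \<exists>p\<in>I. z \<le> sup p a} \<noteq> {}" by auto
next
  fix x y assume "x \<in> {z. \<exists>p\<in>I. z \<le> sup p a} \<and> y \<le> x"
  then show "y \<in> {z. \<exists>p\<in>I. z \<le> sup p a}" using order.trans by blast
next
  fix x y assume "x \<in> {z. \<exists>p\<in>I. z \<le> sup p a}" "y \<in> {z. \<exists>p\<in>I. z \<le> sup p a}"
  then obtain p q where pq: "p \<in> I" "q \<in> I" "x \<le> sup p a" "y \<le> sup q a" by auto
  have "sup x y \<le> sup (sup p q) a"
    using sup_mono[OF pq(3,4)] by (simp add: ac_simps)
  moreover have "sup p q \<in> I" using assms pq by (auto simp: nl_ideal_def)
  ultimately show "sup x y \<in> {z. \<exists>p\<in>I. z \<le> sup p a}" by auto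
qed

text \<open>Zorn's lemma, since the union of a nonempty chain of ideals is an ideal.
  \<open>F\<close> is an arbitrary set: \<open>{top}\<close> will yield maximal ideals, a filter
  will yield prime ones.\<close>

lemma nl_ideal_maximal_disjoint:
  assumes "nl_ideal I" "I \<inter> F = {}"
  obtains P where "nl_ideal P" "I \<subseteq> P" "P \<inter> F = {}"
    "\<And>J. nl_ideal J \<Longrightarrow> P \<subseteq> J \<Longrightarrow> J \<inter> F = {} \<Longrightarrow> J = P"
proof -
  let ?A = "{J. nl_ideal J \<and> I \<subseteq> J \<and> J \<inter> F = {}}"
  have "\<exists>M\<in>?A. \<forall>X\<in>?A. M \<subseteq> X \<longrightarrow> X = M"
  proof (rule subset_Zorn_nonempty)
    show "?A \<noteq> {}" using assms by auto
  next
    fix C assume C: "C \<noteq> {}" "subset.chain ?A C"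
    have sub: "C \<subseteq> ?A" and ch: "\<And>X Y. X \<in> C \<Longrightarrow> Y \<in> C \<Longrightarrow> X \<subseteq> Y \<or> Y \<subseteq> X"
      using C(2) unfolding subset_chain_def by blast+
    obtain J where "J \<in> C" using C(1) by blast
    have "nl_ideal (\<Union>C)"
      unfolding nl_ideal_def
    proof (intro conjI allI ballI impI)
      have "J \<noteq> {}" using sub \<open>J \<in> C\<close> by (auto simp: nl_ideal_def)
      then show "\<Union>C \<noteq> {}" using \<open>J \<in> C\<close> by auto
    next
      fix x y assume "x \<in> \<Union>C \<and> y \<le> x"
      then obtain X where "X \<in> C" "x \<in> X" "y \<le> x" by auto
      moreover have "nl_ideal X" using sub \<open>X \<in> C\<close> by auto
      ultimately show "y \<in> \<Union>C" unfolding nl_ideal_def by blast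
    next
      fix x y assume "x \<in> \<Union>C" "y \<in> \<Union>C"
      then obtain Y Z where YZ: "Y \<in> C" "x \<in> Y" "Z \<in> C" "y \<in> Z" by auto
      then obtain X where X: "X \<in> C" "x \<in> X" "y \<in> X" using ch[of Y Z] by auto
      moreover have "nl_ideal X" using sub \<open>X \<in> C\<close> by auto
      ultimately show "sup x y \<in> \<Union>C" unfolding nl_ideal_def by blast
    qed
    moreover have "I \<subseteq> \<Union>C" using sub \<open>J \<in> C\<close> by auto
    moreover have "\<Union>C \<inter> F = {}" using sub by auto
    ultimately show "\<Union>C \<in> ?A" by simp
  qed
  then obtain P where P: "P \<in> ?A" and mx: "\<forall>X\<in>?A. P \<subseteq> X \<longrightarrow> X = P" by (elim bexE)
  show thesis
  proof (rule that)
    show "nl_ideal P" "I \<subseteq> P" "P \<inter> F = {}" using P by simp_all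
    show "J = P" if "nl_ideal J" "P \<subseteq> J" "J \<inter> F = {}" for J
      using bspec[OF mx, of J] that P by (simp add: subset_trans[OF _ \<open>P \<subseteq> J\<close>])
  qed
qed

lemma nl_maximal_ideal_exists:
  assumes "nl_ideal I" "top \<notin> I"
  obtains M where "nl_maximal_ideal M" "I \<subseteq> M"
proof -
  obtain M where "nl_ideal M" "I \<subseteq> M" "M \<inter> {top} = {}"
    "\<And>J. nl_ideal J \<Longrightarrow> M \<subseteq> J \<Longrightarrow> J \<inter> {top} = {} \<Longrightarrow> J = M"
    using nl_ideal_maximal_disjoint[of I "{top}"] assms by auto
  then have "nl_maximal_ideal M"
    unfolding nl_maximal_ideal_def using nl_ideal_proper_iff by blast
  then show thesis using \<open>I \<subseteq> M\<close> by (rule that)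
qed

text \<open>An ideal maximal among those containing \<open>I\<close> and disjoint from
  \<open>F\<close> is prime.\<close>

lemma nl_prime_ideal_separation:
  assumes "nl_ideal I" "nl_filter F" "I \<inter> F = {}"
  obtains P where "nl_prime_ideal P" "I \<subseteq> P" "P \<inter> F = {}"
proof -
  obtain P where P: "nl_ideal P" "I \<subseteq> P" "P \<inter> F = {}"
    and mx: "\<And>J. nl_ideal J \<Longrightarrow> P \<subseteq> J \<Longrightarrow> J \<inter> F = {} \<Longrightarrow> J = P"
    using nl_ideal_maximal_disjoint assms(1,3) by metis
  have up: "y \<in> F" if "x \<in> F" "x \<le> y" for x y
    using assms(2) that unfolding nl_filter_def by blast
  \<comment> \<open>Maximality in terms of elements: the ideal generated by \<open>P\<close> and
    \<open>u\<close> must meet \<open>F\<close>.\<close>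
  have hit: "\<exists>p\<in>P. sup p u \<in> F" if "u \<notin> P" for u
  proof -
    let ?J = "{z. \<exists>p\<in>P. z \<le> sup p u}"
    obtain p where "p \<in> P" using P(1) by (auto simp: nl_ideal_def)
    then have "u \<in> ?J" by auto
    then have "?J \<noteq> P" using that by blast
    moreover have "P \<subseteq> ?J" using sup_ge1 by blast
    ultimately have "?J \<inter> F \<noteq> {}" using mx nl_ideal_adjoin[OF P(1)] by blast
    then show ?thesis using up by blast
  qed
  have "u \<in> P \<or> v \<in> P" if m: "is_meet_on UNIV u v m" "m \<in> P" for u v m
  proof (rule ccontr)
    assume "\<not> (u \<in> P \<or> v \<in> P)"
    then obtain p q where pq: "p \<in> P" "q \<in> P" "sup p u \<in> F" "sup q v \<in> F"
      using hit by blast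
    \<comment> \<open>One common translate for \<open>u\<close> and \<open>v\<close>, so that
      \<open>sup ?r m\<close> is their translated meet; it then lies in \<open>F\<close> and in
      \<open>P\<close> at once.\<close>
    let ?r = "sup p q"
    have "sup ?r u \<in> F" "sup ?r v \<in> F"
      by (rule up[OF pq(3)], simp add: le_supI1) (rule up[OF pq(4)], simp add: le_supI1)
    then have "sup ?r m \<in> F"
      using sup_is_meet_on[OF m(1), of ?r] assms(2) unfolding nl_filter_def by blast
    moreover have "sup ?r m \<in> P" using P(1) pq m(2) by (auto simp: nl_ideal_def)
    ultimately show False using P(3) by blast
  qed
  moreover have "top \<in> F" using assms(2) by (simp add: nl_filter_def)
  then have "P \<noteq> UNIV" using P(3) by blast
  ultimately have "nl_prime_ideal P" using P(1) unfolding nl_prime_ideal_def by blast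
  then show thesis using P(2,3) by (rule that)
qed

section \<open>Annihilators of joins under normality\<close>

lemma annihilator_sup_subset:
  assumes normal: "\<And>P. nl_prime_ideal P \<Longrightarrow> \<exists>!M. nl_maximal_ideal M \<and> P \<subseteq> M"
    and "nl_filter F" "annihilator a \<subseteq> F" "annihilator b \<subseteq> F"
  shows "annihilator (sup a b) \<subseteq> F"
proof
  fix x assume x: "x \<in> annihilator (sup a b)"
  show "x \<in> F"
  proof (rule ccontr)
    assume "x \<notin> F"
    have "x \<in> F" if "y \<in> F" "y \<le> x" for y
      using assms(2) that unfolding nl_filter_def by blast
    with \<open>x \<notin> F\<close> have "{..x} \<inter> F = {}" by auto
    then obtain P where P: "nl_prime_ideal P" "{..x} \<subseteq> P" "P \<inter> F = {}"
      by (rule nl_prime_ideal_separation[OF nl_ideal_principal assms(2)])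
    have idP: "nl_ideal P" using P(1) by (simp add: nl_prime_ideal_def)
    have xP: "x \<in> P" using P(2) by auto
    \<comment> \<open>To be applied to \<open>a\<close> and \<open>b\<close>. If adjoining
      \<open>c\<close> to \<open>P\<close> produced \<open>top\<close>, some \<open>p\<close> in
      \<open>P\<close> would annihilate \<open>c\<close> and hence lie in \<open>F\<close>, which
      \<open>P\<close> avoids.\<close>
    have ext: "\<exists>M. nl_maximal_ideal M \<and> P \<subseteq> M \<and> c \<in> M" if "annihilator c \<subseteq> F" for c
    proof -
      let ?J = "{z. \<exists>p\<in>P. z \<le> sup p c}"
      have "top \<notin> ?J"
      proof
        assume "top \<in> ?J"
        then obtain p where "p \<in> P" "top \<le> sup p c" by blast
        then have "sup p c = top" by (simp add: top_unique)
        then have "p \<in> F" using \<open>annihilator c \<subseteq> F\<close> unfolding annihilator_def by blast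
        then show False using \<open>p \<in> P\<close> P(3) by blast
      qed
      then obtain M where "nl_maximal_ideal M" "?J \<subseteq> M"
        by (rule nl_maximal_ideal_exists[OF nl_ideal_adjoin[OF idP]])
      moreover have "c \<in> ?J" using xP sup_ge2 by blast
      moreover have "P \<subseteq> ?J" using sup_ge1 by blast
      ultimately show ?thesis by blast
    qed
    obtain M N where M: "nl_maximal_ideal M" "P \<subseteq> M" "a \<in> M"
      and N: "nl_maximal_ideal N" "P \<subseteq> N" "b \<in> N"
      using ext[OF assms(3)] ext[OF assms(4)] by blast
    have "M = N"
      by (rule ex1E[OF normal[OF P(1)]]) (use M N in metis)
    then have "x \<in> M" "a \<in> M" "b \<in> M" using M N xP by auto
    moreover have M': "nl_ideal M" "M \<noteq> UNIV" using M(1) by (simp_all add: nl_maximal_ideal_def)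
    ultimately have "sup x (sup a b) \<in> M"
      unfolding nl_ideal_def by simp
    then have "top \<in> M" using x by (simp add: annihilator_def)
    then show False using M' by (simp add: nl_ideal_proper_iff)
  qed
qed

section \<open>Double annihilators and the two inverse maps\<close>

lemma self_in_double_annihilator: "a \<in> double_annihilator a"
  by (auto simp: double_annihilator_def annihilator_def sup_commute)

lemma annihilator_antimono_double:
  "y \<in> double_annihilator a \<Longrightarrow> annihilator a \<subseteq> annihilator y"
  by (auto simp: double_annihilator_def annihilator_def sup_commute)

lemma annihilator_mono: "x \<le> y \<Longrightarrow> annihilator x \<subseteq> annihilator y"
  by (auto simp: annihilator_def) (metis sup_mono order.refl top_unique)

text \<open>The union is directed: the annihilators of \<open>i\<close> and \<open>j\<close> both
  lie in that of \<open>sup i j\<close>, which gives closure under meets. If \<open>a\<close>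
  annihilates \<open>i\<close>, then \<open>i\<close> annihilates \<open>a\<close>, so all of
  \<open>double_annihilator a\<close> annihilates \<open>i\<close>.\<close>

lemma alpha_filter_Union_annihilator:
  assumes "nl_ideal I"
  shows "alpha_filter (\<Union>i\<in>I. annihilator i)"
  unfolding alpha_filter_def nl_filter_def
proof (intro conjI allI ballI impI)
  obtain i where "i \<in> I" using assms by (auto simp: nl_ideal_def)
  then show "top \<in> (\<Union>i\<in>I. annihilator i)" by (auto simp: annihilator_def sup_absorb1)
next
  fix x y assume "x \<in> (\<Union>i\<in>I. annihilator i) \<and> x \<le> y"
  then show "y \<in> (\<Union>i\<in>I. annihilator i)"
    using nl_filter_annihilator unfolding nl_filter_def by blast
next
  fix x y m
  assume "x \<in> (\<Union>i\<in>I. annihilator i)" "y \<in> (\<Union>i\<in>I. annihilator i)"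
    and m: "is_meet_on UNIV x y m"
  then obtain i j where ij: "i \<in> I" "j \<in> I" "x \<in> annihilator i" "y \<in> annihilator j" by auto
  then have "x \<in> annihilator (sup i j)" "y \<in> annihilator (sup i j)"
    using annihilator_mono sup_ge1 sup_ge2 by blast+
  then have "m \<in> annihilator (sup i j)"
    using nl_filter_annihilator m unfolding nl_filter_def by blast
  moreover have "sup i j \<in> I" using assms ij by (auto simp: nl_ideal_def)
  ultimately show "m \<in> (\<Union>i\<in>I. annihilator i)" by blast
next
  fix a assume "a \<in> (\<Union>i\<in>I. annihilator i)"
  then show "double_annihilator a \<subseteq> (\<Union>i\<in>I. annihilator i)"
    by (auto simp: double_annihilator_def annihilator_def sup_commute)
qed

lemma alpha_ideal_annihilator_subset:
  assumes normal: "\<And>P. nl_prime_ideal P \<Longrightarrow> \<exists>!M. nl_maximal_ideal M \<and> P \<subseteq> M"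
    and quasi: "\<And>a. \<exists>b. double_annihilator a = annihilator b"
    and "nl_filter F"
  shows "alpha_ideal {x. annihilator x \<subseteq> F}"
  unfolding alpha_ideal_def nl_ideal_def
proof (intro conjI allI ballI impI)
  \<comment> \<open>A quasicomplement of \<open>top\<close> shows that the set is nonempty:
    everything annihilates \<open>top\<close>, so \<open>annihilator d\<close> is just
    \<open>{top}\<close> and lies in every filter.\<close>
  obtain d where "double_annihilator top = annihilator d" using quasi by blast
  moreover have "y = top" if "y \<in> double_annihilator top" for y
  proof -
    have "y \<in> annihilator top" by (simp add: annihilator_def sup_absorb2)
    then show ?thesis using that by (auto simp: double_annihilator_def)
  qed
  ultimately have "annihilator d \<subseteq> F" using assms(3) unfolding nl_filter_def by blast
  then show "{x. annihilator x \<subseteq> F} \<noteq> {}" by blast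
next
  fix x y assume "x \<in> {x. annihilator x \<subseteq> F} \<and> y \<le> x"
  then show "y \<in> {x. annihilator x \<subseteq> F}" using annihilator_mono by blast
next
  fix x y assume "x \<in> {x. annihilator x \<subseteq> F}" "y \<in> {x. annihilator x \<subseteq> F}"
  then show "sup x y \<in> {x. annihilator x \<subseteq> F}"
    using annihilator_sup_subset[OF normal assms(3)] by blast
next
  fix a assume "{x. annihilator x \<subseteq> F} \<inter> double_annihilator a \<noteq> {}"
  then show "a \<in> {x. annihilator x \<subseteq> F}" using annihilator_antimono_double by blast
qed

text \<open>A quasicomplement \<open>b\<close> of \<open>x\<close> annihilates \<open>x\<close>, so
  it annihilates some \<open>i\<close> in \<open>I\<close>. Then \<open>i\<close> lies in
  \<open>annihilator b\<close>, which is \<open>double_annihilator x\<close>, and the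
  \<alpha>-condition puts \<open>x\<close> into \<open>I\<close>.\<close>

lemma alpha_ideal_roundtrip:
  assumes quasi: "\<And>a. \<exists>b. double_annihilator a = annihilator b"
    and "alpha_ideal I"
  shows "{x. annihilator x \<subseteq> (\<Union>i\<in>I. annihilator i)} = I"
proof (intro set_eqI iffI)
  fix x assume "x \<in> {x. annihilator x \<subseteq> (\<Union>i\<in>I. annihilator i)}"
  moreover obtain b where b: "double_annihilator x = annihilator b" using quasi by blast
  have "b \<in> annihilator x"
    using self_in_double_annihilator[of x] unfolding b by (auto simp: annihilator_def sup_commute)
  ultimately obtain i where "i \<in> I" "b \<in> annihilator i" by blast
  then have "i \<in> double_annihilator x" unfolding b by (auto simp: annihilator_def sup_commute)
  then show "x \<in> I" using \<open>i \<in> I\<close> assms(2) unfolding alpha_ideal_def by blast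
qed auto

text \<open>For \<open>y\<close> in \<open>F\<close>, a quasicomplement \<open>b\<close> of
  \<open>y\<close> is the index whose annihilator contains \<open>y\<close>: that annihilator is
  \<open>double_annihilator y\<close>, which \<open>F\<close> contains by the
  \<alpha>-condition.\<close>

lemma alpha_filter_roundtrip:
  assumes quasi: "\<And>a. \<exists>b. double_annihilator a = annihilator b"
    and "alpha_filter F"
  shows "(\<Union>i\<in>{x. annihilator x \<subseteq> F}. annihilator i) = F"
proof (intro set_eqI iffI)
  fix y assume "y \<in> F"
  obtain b where b: "double_annihilator y = annihilator b" using quasi by blast
  have "annihilator b \<subseteq> F"
    using \<open>y \<in> F\<close> assms(2) unfolding alpha_filter_def b[symmetric] by blast
  moreover have "y \<in> annihilator b" using self_in_double_annihilator[of y] b by simp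
  ultimately show "y \<in> (\<Union>i\<in>{x. annihilator x \<subseteq> F}. annihilator i)" by blast
qed auto

end

theorem theorem3p14:
  assumes "nl_normal TYPE('a::distributive_nearlattice)"
    and "nl_quasicomplemented TYPE('a)"
  shows "\<exists>f. bij_betw f {I::'a set. alpha_ideal I} {F::'a set. alpha_filter F}"
proof -
  have normal: "\<exists>!M. nl_maximal_ideal M \<and> P \<subseteq> M" if "nl_prime_ideal P" for P :: "'a set"
    using assms(1) that by (auto simp: nl_normal_def)
  have quasi: "\<exists>b. double_annihilator a = annihilator b" for a :: 'a
    using assms(2) by (auto simp: nl_quasicomplemented_def)
  have "bij_betw (\<lambda>I. \<Union>i\<in>I. annihilator i) {I::'a set. alpha_ideal I} {F. alpha_filter F}"
  proof (rule bij_betw_byWitness[where f' = "\<lambda>F. {x. annihilator x \<subseteq> F}"])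
    show "\<forall>I\<in>{I::'a set. alpha_ideal I}. {x. annihilator x \<subseteq> (\<Union>i\<in>I. annihilator i)} = I"
      using alpha_ideal_roundtrip[OF quasi] by blast
    show "\<forall>F\<in>{F::'a set. alpha_filter F}. (\<Union>i\<in>{x. annihilator x \<subseteq> F}. annihilator i) = F"
      using alpha_filter_roundtrip[OF quasi] by blast
    show "(\<lambda>I. \<Union>i\<in>I. annihilator i) ` {I::'a set. alpha_ideal I} \<subseteq> {F. alpha_filter F}"
      using alpha_filter_Union_annihilator by (auto simp: alpha_ideal_def)
    show "(\<lambda>F. {x. annihilator x \<subseteq> F}) ` {F::'a set. alpha_filter F} \<subseteq> {I. alpha_ideal I}"
      using alpha_ideal_annihilator_subset[OF normal quasi] by (auto simp: alpha_filter_def)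
  qed
  then show ?thesis by blast
qed

end
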